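(* There is an algorithm which, given a positive integer $n$ and a vector $x \in \mathbb{R}^n$, computes the matrix-vector product $Q_n x$ in $O(n \log^2 n)$ time in exact arithmetic.
   Context: The $\ell_\infty$-normalized lower triangular Pascal matrix $Q_n \in \mathbb{R}^{n\times n}$ (zero-indexed) has entries, for $0 \le i,j \le n-1$, $(Q_n)_{ij} = 2^{-i}\binom{i}{j}$ if $i \ge j$, and $(Q_n)_{ij} = 0$ otherwise. Time is measured as the number of exact arithmetic operations on real or complex numbers (additions, subtractions, multiplications, divisions, with the roots of unity used by the fast Fourier transform available). In this model the discrete Fourier transform of length $n$, and hence the convolution of vectors of length $O(n)$, can be computed in $O(n\log n)$ time. *)

theory Defs
  imports
    Complex_Main
    "HOL-Library.Landau_Symbols"
    "Jordan_Normal_Form.Matrix"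
begin

section \<open>The normalized Pascal matrix\<close>

definition pascal_Q :: "nat \<Rightarrow> real mat" where
  "pascal_Q n = mat n n (\<lambda>(i, j). if i \<ge> j then real (i choose j) / 2 ^ i else 0)"

section \<open>Exact-arithmetic algorithms\<close>

text \<open>
  An algorithm is a single program of a while language, used for all input sizes.  It has
  natural-number variables for indices and control, and arrays of complex numbers.
  Complex data never flows into the index part.  The time of a run is the number of
  operations \<open>+\<close>, \<open>-\<close>, \<open>*\<close>, \<open>/\<close> it performs on complex numbers; index arithmetic, tests,
  copying of cells, integer literals and roots of unity are not charged.
\<close>

type_synonym store = "string \<Rightarrow> nat"
type_synonym memory = "string \<Rightarrow> nat \<Rightarrow> complex"
type_synonym state = "store \<times> memory"

datatype iexp =
    INum nat | IVar string
  | IAdd iexp iexp | ISub iexp iexp | IMul iexp iexp | IDiv iexp iexp | IMod iexp iexp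

primrec ival :: "store \<Rightarrow> iexp \<Rightarrow> nat" where
  "ival \<sigma> (INum k) = k"
| "ival \<sigma> (IVar v) = \<sigma> v"
| "ival \<sigma> (IAdd a b) = ival \<sigma> a + ival \<sigma> b"
| "ival \<sigma> (ISub a b) = ival \<sigma> a - ival \<sigma> b"
| "ival \<sigma> (IMul a b) = ival \<sigma> a * ival \<sigma> b"
| "ival \<sigma> (IDiv a b) = ival \<sigma> a div ival \<sigma> b"
| "ival \<sigma> (IMod a b) = ival \<sigma> a mod ival \<sigma> b"

datatype bexp = BLess iexp iexp | BNot bexp | BAnd bexp bexp

primrec bval :: "store \<Rightarrow> bexp \<Rightarrow> bool" where
  "bval \<sigma> (BLess a b) \<longleftrightarrow> ival \<sigma> a < ival \<sigma> b"
| "bval \<sigma> (BNot p) \<longleftrightarrow> \<not> bval \<sigma> p"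
| "bval \<sigma> (BAnd p q) \<longleftrightarrow> bval \<sigma> p \<and> bval \<sigma> q"

text \<open>\<open>CRoot k m\<close> is the root of unity \<open>exp (2 \<pi> i k / m)\<close>.\<close>

datatype cexp =
    CInt int | CRoot iexp iexp | CCell string iexp
  | CAdd cexp cexp | CSub cexp cexp | CMul cexp cexp | CDiv cexp cexp

primrec cval :: "state \<Rightarrow> cexp \<Rightarrow> complex" where
  "cval s (CInt z) = of_int z"
| "cval s (CRoot k m) = cis (2 * pi * real (ival (fst s) k) / real (ival (fst s) m))"
| "cval s (CCell A i) = snd s A (ival (fst s) i)"
| "cval s (CAdd a b) = cval s a + cval s b"
| "cval s (CSub a b) = cval s a - cval s b"
| "cval s (CMul a b) = cval s a * cval s b"
| "cval s (CDiv a b) = cval s a / cval s b"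

text \<open>Evaluation must not use HOL's \<open>x / 0 = 0\<close>: a program that divides by zero is stuck.\<close>

primrec cdefined :: "state \<Rightarrow> cexp \<Rightarrow> bool" where
  "cdefined s (CInt z) \<longleftrightarrow> True"
| "cdefined s (CRoot k m) \<longleftrightarrow> ival (fst s) m > 0"
| "cdefined s (CCell A i) \<longleftrightarrow> True"
| "cdefined s (CAdd a b) \<longleftrightarrow> cdefined s a \<and> cdefined s b"
| "cdefined s (CSub a b) \<longleftrightarrow> cdefined s a \<and> cdefined s b"
| "cdefined s (CMul a b) \<longleftrightarrow> cdefined s a \<and> cdefined s b"
| "cdefined s (CDiv a b) \<longleftrightarrow> cdefined s a \<and> cdefined s b \<and> cval s b \<noteq> 0"

primrec ccost :: "cexp \<Rightarrow> nat" where
  "ccost (CInt z) = 0"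
| "ccost (CRoot k m) = 0"
| "ccost (CCell A i) = 0"
| "ccost (CAdd a b) = ccost a + ccost b + 1"
| "ccost (CSub a b) = ccost a + ccost b + 1"
| "ccost (CMul a b) = ccost a + ccost b + 1"
| "ccost (CDiv a b) = ccost a + ccost b + 1"

datatype com =
    Skip
  | ISet string iexp
  | Store string iexp cexp
  | Seq com com
  | If bexp com com
  | While bexp com

text \<open>\<open>exec c s t s'\<close>: program \<open>c\<close>, started in state \<open>s\<close>, terminates in \<open>s'\<close> after \<open>t\<close>
  arithmetic operations.\<close>

inductive exec :: "com \<Rightarrow> state \<Rightarrow> nat \<Rightarrow> state \<Rightarrow> bool" where
  Skip: "exec Skip s 0 s"
| ISet: "exec (ISet v a) (\<sigma>, \<mu>) 0 (\<sigma>(v := ival \<sigma> a), \<mu>)"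
| Store: "cdefined (\<sigma>, \<mu>) e \<Longrightarrow>
    exec (Store A i e) (\<sigma>, \<mu>) (ccost e) (\<sigma>, \<mu>(A := (\<mu> A)(ival \<sigma> i := cval (\<sigma>, \<mu>) e)))"
| Seq: "exec c s t s' \<Longrightarrow> exec d s' t' s'' \<Longrightarrow> exec (Seq c d) s (t + t') s''"
| IfTrue: "bval (fst s) b \<Longrightarrow> exec c s t s' \<Longrightarrow> exec (If b c d) s t s'"
| IfFalse: "\<not> bval (fst s) b \<Longrightarrow> exec d s t s' \<Longrightarrow> exec (If b c d) s t s'"
| WhileFalse: "\<not> bval (fst s) b \<Longrightarrow> exec (While b c) s 0 s"
| WhileTrue: "bval (fst s) b \<Longrightarrow> exec c s t s' \<Longrightarrow> exec (While b c) s' t' s'' \<Longrightarrow>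
    exec (While b c) s (t + t') s''"

lemma exec_deterministic:
  "exec c s t s' \<Longrightarrow> exec c s u s'' \<Longrightarrow> u = t \<and> s'' = s'"
proof (induction arbitrary: u s'' rule: exec.induct)
  case (WhileTrue s b c t s' t' s2)
  from WhileTrue.prems WhileTrue.hyps WhileTrue.IH show ?case
    by (cases rule: exec.cases) blast+
next
  case (Seq c s t s' d t' s2)
  from Seq.prems Seq.IH show ?case
    by (cases rule: exec.cases) blast+
qed (erule exec.cases; fastforce)+

text \<open>The input size is in the index variable \<open>n\<close> and the input vector in the array \<open>x\<close>;
  everything else is initially zero.  The result is read from the array \<open>y\<close>.\<close>

definition input_state :: "nat \<Rightarrow> real vec \<Rightarrow> state" where
  "input_state n x =
    ((\<lambda>_. 0)(''n'' := n),
     (\<lambda>_ _. 0)(''x'' := (\<lambda>i. if i < n then complex_of_real (x $ i) else 0)))"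

definition output_vec :: "nat \<Rightarrow> state \<Rightarrow> complex vec" where
  "output_vec n s = vec n (\<lambda>i. snd s ''y'' i)"

end

theory Submission
  imports Defs "HOL-Real_Asymp.Real_Asymp"
begin

text \<open>Since \<open>binom i j = i! / (j! (i - j)!)\<close>, the matrix factors as
  \<open>Q = diag (i! / 2 ^ i) * T * diag (1 / j!)\<close> with \<open>T\<close> Toeplitz, so that \<open>Q x\<close> is a rescaled
  convolution of \<open>x_j / j!\<close> with \<open>1 / k!\<close>.  In exact arithmetic the factorials and powers of two
  cost \<open>O(n)\<close>, and one convolution by the fast Fourier transform of length \<open>2 ^ L \<ge> 2 n\<close>
  even gives \<open>O(n log n)\<close>.\<close>

section \<open>Total correctness with a cost bound\<close>

text \<open>Total correctness: the run must exist, which excludes divergence and division by zero,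
  and by \<open>exec_deterministic\<close> it is the only run.\<close>

definition runs :: "(state \<Rightarrow> bool) \<Rightarrow> com \<Rightarrow> nat \<Rightarrow> (state \<Rightarrow> bool) \<Rightarrow> bool" where
  "runs P c B Q \<longleftrightarrow> (\<forall>s. P s \<longrightarrow> (\<exists>t s'. exec c s t s' \<and> t \<le> B \<and> Q s'))"

lemma runs_pre:
  "runs P' c B' Q \<Longrightarrow> (\<And>s. P s \<Longrightarrow> P' s) \<Longrightarrow> B' \<le> B \<Longrightarrow> runs P c B Q"
  unfolding runs_def by (meson le_trans)

lemma runs_post: "runs P c B Q' \<Longrightarrow> (\<And>s. Q' s \<Longrightarrow> Q s) \<Longrightarrow> runs P c B Q"
  unfolding runs_def by blast

lemma runs_ISet: "runs (\<lambda>s. Q ((fst s)(v := ival (fst s) a), snd s)) (ISet v a) 0 Q"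
  unfolding runs_def by (metis exec.ISet le_refl prod.collapse)

lemma runs_Store:
  "runs (\<lambda>s. cdefined s e \<and>
     Q (fst s, (snd s)(A := (snd s A)(ival (fst s) i := cval s e)))) (Store A i e) (ccost e) Q"
  unfolding runs_def by (metis exec.Store le_refl prod.collapse)

text \<open>With the premise on the second command first, resolution from a known postcondition
  \<open>Q\<close> computes \<open>R\<close> backwards.\<close>

lemma runs_Seq: "runs R d C Q \<Longrightarrow> runs P c B R \<Longrightarrow> runs P (Seq c d) (B + C) Q"
  unfolding runs_def by (meson exec.Seq add_mono)

text \<open>The invariant is indexed by the number of completed iterations; the test fixes the total
  at \<open>m\<close>, which yields both termination and the cost.\<close>

lemma runs_While:
  assumes body: "\<And>k. k < m \<Longrightarrow> runs (I k) c B (I (Suc k))"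
    and test: "\<And>k s. k \<le> m \<Longrightarrow> I k s \<Longrightarrow> bval (fst s) b \<longleftrightarrow> k < m"
  shows "runs (I 0) (While b c) (m * B) (I m)"
proof -
  have "\<exists>t s'. exec (While b c) s t s' \<and> t \<le> j * B \<and> I m s'" if "j \<le> m" "I (m - j) s" for j s
    using that
  proof (induction j arbitrary: s)
    case 0
    then have "\<not> bval (fst s) b" using test[of m s] by simp
    then show ?case using 0 exec.WhileFalse by fastforce
  next
    case (Suc j)
    have b: "bval (fst s) b" using test[of "m - Suc j" s] Suc.prems by simp
    obtain t s' where 1: "exec c s t s'" "t \<le> B" "I (m - j) s'"
      using body[of "m - Suc j"] Suc.prems unfolding runs_def
      by (metis Suc_diff_Suc diff_less less_eq_Suc_le zero_less_Suc order_less_le_trans)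
    obtain t' s'' where "exec (While b c) s' t' s''" "t' \<le> j * B" "I m s''"
      using Suc.IH[of s'] 1 Suc.prems by auto
    then have "exec (While b c) s (t + t') s''" "t + t' \<le> Suc j * B"
      using exec.WhileTrue[OF b 1(1)] 1(2) by auto
    then show ?case using \<open>I m s''\<close> by blast
  qed
  from this[of m] show ?thesis unfolding runs_def by simp
qed

section \<open>The discrete Fourier transform\<close>

definition root_pow :: "nat \<Rightarrow> nat \<Rightarrow> complex" where
  "root_pow N j = cis (2 * pi * real j / real N)"

lemma root_pow_add: "root_pow N (i + j) = root_pow N i * root_pow N j"
  by (simp add: root_pow_def cis_mult add_divide_distrib distrib_left)

lemma root_pow_0 [simp]: "root_pow N 0 = 1"
  by (simp add: root_pow_def)

lemma root_pow_mult: "root_pow N (i * j) = root_pow N i ^ j"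
  by (induction j) (simp_all add: root_pow_add)

lemma root_pow_self: "N > 0 \<Longrightarrow> root_pow N N = 1"
  by (simp add: root_pow_def)

lemma root_pow_mod: "N > 0 \<Longrightarrow> root_pow N (j mod N) = root_pow N j"
proof -
  assume "N > 0"
  have "root_pow N j = root_pow N (N * (j div N) + j mod N)" by simp
  also have "\<dots> = root_pow N (j mod N)"
    unfolding root_pow_add root_pow_mult by (simp add: root_pow_self \<open>N > 0\<close>)
  finally show ?thesis by simp
qed

lemma root_pow_cong: "N > 0 \<Longrightarrow> i mod N = j mod N \<Longrightarrow> root_pow N i = root_pow N j"
  by (metis root_pow_mod)

text \<open>After reduction of \<open>j\<close> modulo \<open>N\<close> the angle lies in
  \<open>[0, 2 pi)\<close>, where the cosine is 1 only at 0.\<close>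

lemma root_pow_eq_1:
  assumes "N > 0" "root_pow N j = 1" shows "N dvd j"
proof (rule ccontr)
  assume "\<not> N dvd j"
  then have r: "0 < j mod N" "j mod N < N" using assms(1) by (auto simp: dvd_eq_mod_eq_0)
  have "cis (2 * pi * (real (j mod N) / real N)) = 1"
    using assms root_pow_mod[OF assms(1), of j] by (simp add: root_pow_def)
  then have "cos (2 * pi * (real (j mod N) / real N)) = 1"
    by (metis cis.sel(1) one_complex.sel(1))
  then obtain k :: int where "2 * pi * (real (j mod N) / real N) = of_int k * 2 * pi"
    unfolding cos_one_2pi_int by auto
  then have "real (j mod N) = of_int k * real N" using assms(1) by (simp add: field_simps)
  then have "real_of_int (int (j mod N)) = real_of_int (k * int N)" by simp
  then have "int (j mod N) = k * int N" by (simp only: of_int_eq_iff)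
  then have "int N dvd int (j mod N)" by simp
  then show False using r by (auto dest: dvd_imp_le)
qed

text \<open>Orthogonality of characters: a geometric sum whose ratio is either 1 or another
  \<open>N\<close>-th root of unity.\<close>

lemma sum_root_pow:
  assumes "N > 0"
  shows "(\<Sum>p<N. root_pow N (j * p)) = (if N dvd j then of_nat N else 0)"
proof (cases "N dvd j")
  case True
  then have "root_pow N j = 1" using root_pow_cong[OF assms, of j 0] by auto
  then show ?thesis using True by (simp add: root_pow_mult)
next
  case False
  then have ne: "root_pow N j \<noteq> 1" using root_pow_eq_1 assms by blast
  have "root_pow N j ^ N = 1"
    using root_pow_mult[of N j N] root_pow_cong[OF assms, of "j * N" 0] by simp
  then show ?thesis using False ne by (simp add: root_pow_mult sum_gp_strict)
qed

section \<open>The transform, its convolution property and its radix-two splitting\<close>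

definition dft :: "nat \<Rightarrow> (nat \<Rightarrow> complex) \<Rightarrow> nat \<Rightarrow> complex" where
  "dft N a p = (\<Sum>m<N. a m * root_pow N (p * m))"

text \<open>A forward transform read at \<open>- i\<close> modulo \<open>N\<close> replaces the inverse transform.\<close>

lemma dft_convolution:
  assumes n: "2 * n \<le> N" and i: "i < n"
    and a: "\<And>m. m \<ge> n \<Longrightarrow> a m = 0" and b: "\<And>m. m \<ge> n \<Longrightarrow> b m = 0"
  shows "dft N (\<lambda>p. dft N a p * dft N b p) ((N - i) mod N) = of_nat N * (\<Sum>j\<le>i. a j * b (i - j))"
proof -
  have N: "N > 0" using n i by simp
  \<comment> \<open>No wrap-around: as \<open>2 * n \<le> N\<close>, the number
    \<open>N - i + j + k\<close> lies strictly between 0 and \<open>2 * N\<close>, so it can only be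
    the multiple \<open>N\<close> itself.\<close>
  have dvd: "N dvd N - i + j + k \<longleftrightarrow> j + k = i" if "j < n" "k < n" for j k
  proof
    assume "N dvd N - i + j + k"
    then obtain q where q: "N - i + j + k = N * q" by (auto elim: dvdE)
    have "N * q < N * 2" "0 < N * q" using that i n q[symmetric] by linarith+
    then have "q = 1" by auto
    then show "j + k = i" using q i n by simp
  next
    assume "j + k = i"
    then have "N - i + j + k = N" using i n by simp
    then show "N dvd N - i + j + k" by simp
  qed
  \<comment> \<open>The outer \<open>mod N\<close> sends the index \<open>N\<close>, which arises
    for \<open>i = 0\<close>, back to 0; the roots do not notice it.\<close>
  have rt: "root_pow N (p * j) * root_pow N (p * k) * root_pow N ((N - i) mod N * p)
      = root_pow N ((N - i + j + k) * p)" for p j k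
  proof -
    have "root_pow N ((N - i) mod N * p) = root_pow N ((N - i) * p)"
      by (rule root_pow_cong[OF N]) (simp add: mod_mult_left_eq)
    then show ?thesis
      by (simp only: distrib_left distrib_right root_pow_add mult_ac)
  qed
  have "dft N (\<lambda>p. dft N a p * dft N b p) ((N - i) mod N)
      = (\<Sum>p<N. \<Sum>j<N. \<Sum>k<N. a j * b k * root_pow N ((N - i + j + k) * p))"
    unfolding dft_def sum_product
    unfolding sum_distrib_right rt[symmetric]
    by (intro sum.cong refl) (simp add: mult_ac)
  \<comment> \<open>Summing over \<open>p\<close> first lets orthogonality select the pairs with
    \<open>j + k = i\<close>.\<close>
  also have "\<dots> = (\<Sum>j<N. \<Sum>k<N. a j * b k * (\<Sum>p<N. root_pow N ((N - i + j + k) * p)))"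
    unfolding sum_distrib_left
    by (subst sum.swap, rule sum.cong[OF refl], rule sum.swap)
  also have "\<dots> = (\<Sum>j<N. \<Sum>k<N. if k = i - j \<and> j \<le> i then of_nat N * (a j * b k) else 0)"
  proof (intro sum.cong refl)
    fix j k
    show "a j * b k * (\<Sum>p<N. root_pow N ((N - i + j + k) * p))
        = (if k = i - j \<and> j \<le> i then of_nat N * (a j * b k) else 0)"
    proof (cases "j < n \<and> k < n")
      case True
      then show ?thesis unfolding sum_root_pow[OF N] using dvd[of j k] by auto
    next
      case False
      then have "a j * b k = 0" using a b by (auto simp: not_less)
      then show ?thesis by (simp only: mult_zero_left mult_zero_right if_cancel)
    qed
  qed
  also have "\<dots> = (\<Sum>j<N. if j \<le> i then of_nat N * (a j * b (i - j)) else 0)"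
    using n i by (intro sum.cong refl) (auto simp: sum.delta)
  also have "\<dots> = (\<Sum>j\<in>{j\<in>{..<N}. j \<le> i}. of_nat N * (a j * b (i - j)))"
    by (rule sum.inter_filter[symmetric]) simp
  also have "{j\<in>{..<N}. j \<le> i} = {..i}" using n i by auto
  finally show ?thesis by (simp add: sum_distrib_left)
qed

text \<open>With \<open>N = M * S\<close>, \<open>partial_dft a M S (r + k * S)\<close> for \<open>r < S\<close> and \<open>k < M\<close> is the entry
  \<open>k\<close> of the transform of length \<open>M\<close> of the subsequence of \<open>a\<close> with offset \<open>r\<close> and stride
  \<open>S\<close>; the cases \<open>M = 1\<close> and \<open>S = 1\<close> are the input and the full transform.\<close>

definition partial_dft :: "(nat \<Rightarrow> complex) \<Rightarrow> nat \<Rightarrow> nat \<Rightarrow> nat \<Rightarrow> complex" where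
  "partial_dft a M S p = (\<Sum>m<M. a (p mod S + m * S) * root_pow (M * S) (p div S * S * m))"

lemma partial_dft_1: "p < N \<Longrightarrow> partial_dft a 1 N p = a p"
  by (simp add: partial_dft_def)

lemma partial_dft_full: "partial_dft a N 1 p = dft N a p"
  by (simp add: partial_dft_def dft_def)

lemma sum_even_odd:
  fixes f :: "nat \<Rightarrow> 'a :: comm_monoid_add"
  shows "(\<Sum>m<2 * M. f m) = (\<Sum>m<M. f (2 * m)) + (\<Sum>m<M. f (2 * m + 1))"
  by (induction M) (simp_all add: ac_simps)

text \<open>Cooley-Tukey splitting: the even and odd terms of the subsequence with offset
  \<open>r\<close> and stride \<open>S\<close> have stride \<open>2 * S\<close> and offsets
  \<open>r\<close> and \<open>r + S\<close>. One formula serves both halves of a butterfly: adding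
  \<open>M\<close> to \<open>p div S\<close> leaves \<open>q\<close> unchanged and flips the sign of
  the root.\<close>

lemma partial_dft_step:
  fixes p :: nat
  assumes S: "S > 0" and M: "M > 0"
  defines "N \<equiv> 2 * M * S"
  defines "q \<equiv> p mod S + p div S * (2 * S) mod N"
  shows "partial_dft a (2 * M) S p =
    partial_dft a M (2 * S) q + root_pow N (p div S * S) * partial_dft a M (2 * S) (q + S)"
proof -
  define r k where "r = p mod S" and "k = p div S"
  have r: "r < S" using S by (simp add: r_def)
  have N: "N > 0" using S M by (simp add: N_def)
  have q: "q = r + (k mod M) * (2 * S)"
  proof -
    have "N = M * (2 * S)" by (simp add: N_def)
    then show ?thesis unfolding q_def r_def k_def by (simp add: mult_mod_left)
  qed
  have NM: "M * (2 * S) = N" "2 * M * S = N" by (simp_all add: N_def)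
  \<comment> \<open>Dropping \<open>mod M\<close> changes the exponent by a multiple of
    \<open>N\<close>; what remains is the exponent of the even terms.\<close>
  have w: "root_pow N (k mod M * (2 * S) * m) = root_pow N (k * S * (2 * m))" for m
  proof (rule root_pow_cong[OF N])
    have "k mod M * (2 * S) = (k * (2 * S)) mod N"
      unfolding NM(1)[symmetric] by (simp add: mult_mod_left)
    then have "k mod M * (2 * S) * m mod N = k * (2 * S) * m mod N"
      by (simp only: mod_mult_left_eq)
    then show "k mod M * (2 * S) * m mod N = k * S * (2 * m) mod N"
      by (simp only: mult_ac)
  qed
  have e: "q mod (2 * S) = r" "q div (2 * S) = k mod M"
    "(q + S) mod (2 * S) = r + S" "(q + S) div (2 * S) = k mod M"
  proof -
    have "r < 2 * S" "r + S < 2 * S" using r by auto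
    moreover have qS: "q + S = (r + S) + (k mod M) * (2 * S)" by (simp add: q)
    ultimately show "q mod (2 * S) = r" "q div (2 * S) = k mod M"
      "(q + S) mod (2 * S) = r + S" "(q + S) div (2 * S) = k mod M"
      unfolding qS unfolding q using S by simp_all
  qed
  show ?thesis
    unfolding partial_dft_def e NM sum_even_odd r_def[symmetric] k_def[symmetric] w
    by (simp add: sum_distrib_left root_pow_add distrib_left algebra_simps)
qed


section \<open>The fast Fourier transform\<close>

text \<open>After \<open>l\<close> rounds the cells \<open>l * N, \<dots>, l * N + N - 1\<close> hold the partial transforms with
  stride \<open>S = N / 2 ^ l\<close>, so no bit reversal is needed.\<close>

definition fft_load :: iexp where
  "fft_load = IAdd (IMul (IVar ''l'') (IVar ''N''))
     (IAdd (IMod (IVar ''p'') (IVar ''S''))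
       (IMod (IMul (IDiv (IVar ''p'') (IVar ''S'')) (IMul (INum 2) (IVar ''S''))) (IVar ''N'')))"

definition fft_cell :: "string \<Rightarrow> com" where
  "fft_cell A =
     Seq (Store A (IAdd (IMul (IAdd (IVar ''l'') (INum 1)) (IVar ''N'')) (IVar ''p''))
       (CAdd (CCell A fft_load)
         (CMul (CRoot (IMul (IDiv (IVar ''p'') (IVar ''S'')) (IVar ''S'')) (IVar ''N''))
           (CCell A (IAdd fft_load (IVar ''S''))))))
     (ISet ''p'' (IAdd (IVar ''p'') (INum 1)))"

definition fft_round :: "string \<Rightarrow> com" where
  "fft_round A =
     Seq (ISet ''S'' (IDiv (IVar ''S'') (INum 2)))
     (Seq (ISet ''p'' (INum 0))
     (Seq (While (BLess (IVar ''p'') (IVar ''N'')) (fft_cell A))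
     (ISet ''l'' (IAdd (IVar ''l'') (INum 1)))))"

definition fft :: "string \<Rightarrow> com" where
  "fft A =
     Seq (ISet ''S'' (IVar ''N''))
     (Seq (ISet ''l'' (INum 0))
     (While (BLess (INum 1) (IVar ''S'')) (fft_round A)))"

text \<open>With \<open>s0\<close> the state at entry, this lets the tables and the other arrays
  survive a transform.\<close>

definition fft_frame :: "string \<Rightarrow> state \<Rightarrow> state \<Rightarrow> bool" where
  "fft_frame A s0 s \<longleftrightarrow>
     (\<forall>v. v \<notin> {''l'', ''S'', ''p''} \<longrightarrow> fst s v = fst s0 v) \<and> (\<forall>B. B \<noteq> A \<longrightarrow> snd s B = snd s0 B)"

definition fft_inv :: "string \<Rightarrow> nat \<Rightarrow> state \<Rightarrow> nat \<Rightarrow> state \<Rightarrow> bool" where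
  "fft_inv A L s0 l s \<longleftrightarrow> fft_frame A s0 s \<and> fst s ''l'' = l \<and> fst s ''S'' = 2 ^ (L - l) \<and>
     (\<forall>p<2 ^ L. snd s A (l * 2 ^ L + p) = partial_dft (snd s0 A) (2 ^ l) (2 ^ (L - l)) p)"

text \<open>\<open>S\<close> is already halved here: the level being read has stride
  \<open>2 * S\<close>, the level being written has stride \<open>S\<close>.\<close>

definition fft_round_inv :: "string \<Rightarrow> nat \<Rightarrow> state \<Rightarrow> nat \<Rightarrow> nat \<Rightarrow> state \<Rightarrow> bool" where
  "fft_round_inv A L s0 l k s \<longleftrightarrow> fft_frame A s0 s \<and> fst s ''l'' = l \<and>
     fst s ''S'' = 2 ^ (L - Suc l) \<and> fst s ''p'' = k \<and>
     (\<forall>p<2 ^ L. snd s A (l * 2 ^ L + p) = partial_dft (snd s0 A) (2 ^ l) (2 ^ (L - l)) p) \<and>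
     (\<forall>p<k. snd s A (Suc l * 2 ^ L + p) =
        partial_dft (snd s0 A) (2 ^ Suc l) (2 ^ (L - Suc l)) p)"

text \<open>This is \<open>partial_dft_step\<close> on one cell, at the cost of one multiplication
  by a root and one addition.\<close>

lemma runs_fft_cell:
  assumes N: "fst s0 ''N'' = 2 ^ L" and l: "l < L" and k: "k < 2 ^ L"
  shows "runs (fft_round_inv A L s0 l k) (fft_cell A) 2 (fft_round_inv A L s0 l (Suc k))"
proof -
  define M S :: nat where "M = 2 ^ l" and "S = 2 ^ (L - Suc l)"
  have L: "L - l = Suc (L - Suc l)" using l by simp
  have "L = Suc l + (L - Suc l)" using l by simp
  then have NMS: "2 ^ L = 2 * M * S" unfolding M_def S_def by (metis power_add power_Suc)
  have MS: "M > 0" "S > 0" by (simp_all add: M_def S_def)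
  define q where "q = k mod S + k div S * (2 * S) mod 2 ^ L"
  \<comment> \<open>Both cells read must lie in level \<open>l\<close>, whose contents the invariant
    knows.\<close>
  have q: "q + S < 2 ^ L"
  proof -
    have "k div S * (2 * S) mod 2 ^ L = (k div S mod M) * (2 * S)"
      unfolding NMS by (metis mult.assoc mult.left_commute mult_mod_left)
    moreover have "k div S mod M + 1 \<le> M" using MS by (simp add: Suc_leI)
    then have "(k div S mod M + 1) * (2 * S) \<le> M * (2 * S)" by (rule mult_right_mono) simp
    moreover have "k mod S < S" using MS by simp
    ultimately show ?thesis unfolding q_def NMS by (simp add: algebra_simps)
  qed
  have main: "snd s A (l * 2 ^ L + q) + cis (2 * pi * real (k div S * S) / real (2 ^ L)) *
        snd s A (l * 2 ^ L + q + S) =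
      partial_dft (snd s0 A) (2 ^ Suc l) S k"
    if "\<forall>p<2 ^ L. snd s A (l * 2 ^ L + p) = partial_dft (snd s0 A) (2 ^ l) (2 ^ (L - l)) p" for s
  proof -
    have e: "2 ^ (L - l) = 2 * S" "2 ^ Suc l = 2 * M" unfolding L S_def M_def by simp_all
    have "snd s A (l * 2 ^ L + q) = partial_dft (snd s0 A) M (2 * S) q"
      "snd s A (l * 2 ^ L + q + S) = partial_dft (snd s0 A) M (2 * S) (q + S)"
      using that q unfolding e M_def[symmetric] by (simp_all add: add.assoc)
    then show ?thesis
      unfolding e using partial_dft_step[OF MS(2,1), of "snd s0 A" k]
      unfolding NMS[symmetric] q_def[symmetric] root_pow_def by simp
  qed
  have step: "fft_round_inv A L s0 l (Suc k)
      ((fst s)(''p'' := Suc k), (snd s)(A := (snd s A)((l + 1) * 2 ^ L + k :=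
        snd s A (l * 2 ^ L + q) + cis (2 * pi * real (k div S * S) / real (2 ^ L)) *
        snd s A (l * 2 ^ L + q + S))))"
    if inv: "fft_round_inv A L s0 l k s" for s
  proof -
    have "\<forall>p<2 ^ L. snd s A (l * 2 ^ L + p) = partial_dft (snd s0 A) (2 ^ l) (2 ^ (L - l)) p"
      using inv by (simp add: fft_round_inv_def)
    note * = main[OF this]
    \<comment> \<open>The write goes to level \<open>l + 1\<close>, so level \<open>l\<close> and
      the earlier entries of the new level stay intact.\<close>
    show ?thesis unfolding *
      using inv by (auto simp: fft_round_inv_def fft_frame_def less_Suc_eq S_def)
  qed
  show ?thesis
    unfolding fft_cell_def
    apply (rule runs_pre)
      apply (rule runs_Seq runs_ISet runs_Store)+
    subgoal premises inv for s
    proof -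
      have v: "fst s ''l'' = l" "fst s ''S'' = S" "fst s ''p'' = k" "fst s ''N'' = 2 ^ L"
        using inv N by (auto simp: fft_round_inv_def fft_frame_def S_def)
      show ?thesis
        using step[OF inv] by (simp add: fft_load_def v q_def)
    qed
    apply (simp add: fft_load_def)
    done
qed


lemma runs_fft_round:
  assumes N: "fst s0 ''N'' = 2 ^ L" and l: "l < L"
  shows "runs (fft_inv A L s0 l) (fft_round A) (2 ^ L * 2) (fft_inv A L s0 (Suc l))"
proof -
  have loop: "runs (fft_round_inv A L s0 l 0) (While (BLess (IVar ''p'') (IVar ''N'')) (fft_cell A))
      (2 ^ L * 2) (fft_round_inv A L s0 l (2 ^ L))"
  proof (rule runs_While)
    show "bval (fst s) (BLess (IVar ''p'') (IVar ''N'')) \<longleftrightarrow> k < 2 ^ L"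
      if "fft_round_inv A L s0 l k s" for k s
      using that N by (auto simp: fft_round_inv_def fft_frame_def)
  qed (rule runs_fft_cell[OF N l])
  have post: "fft_round_inv A L s0 l (2 ^ L) s \<Longrightarrow>
      fft_inv A L s0 (Suc l) ((fst s)(''l'' := Suc l), snd s)" for s
    by (auto simp: fft_round_inv_def fft_inv_def fft_frame_def)
  have pre: "fft_inv A L s0 l s \<Longrightarrow>
      fft_round_inv A L s0 l 0 ((fst s)(''S'' := fst s ''S'' div 2, ''p'' := 0), snd s)" for s
    using l by (auto simp: fft_round_inv_def fft_inv_def fft_frame_def Suc_diff_Suc[symmetric])
  show ?thesis
    unfolding fft_round_def
    apply (rule runs_pre)
      apply (rule runs_Seq)+
         apply (rule runs_ISet)
        apply (rule runs_post[OF loop])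
    subgoal for s using post[of s] by (simp add: fft_round_inv_def)
       apply (rule runs_ISet)
      apply (rule runs_ISet)
    subgoal for s using pre[of s] by simp
    by simp
qed

text \<open>The second hypothesis lets each caller derive its own postcondition by comparing the
  states at entry and exit. The cost is \<open>L\<close> rounds over \<open>2 ^ L\<close> cells with
  two operations each.\<close>

lemma runs_fft:
  assumes N: "\<And>s. P s \<Longrightarrow> fst s ''N'' = 2 ^ L"
    and Q: "\<And>s s'. P s \<Longrightarrow> fft_frame A s s' \<Longrightarrow>
      (\<And>p. p < 2 ^ L \<Longrightarrow> snd s' A (L * 2 ^ L + p) = dft (2 ^ L) (snd s A) p) \<Longrightarrow> Q s'"
  shows "runs P (fft A) (L * (2 ^ L * 2)) Q"
proof -
  \<comment> \<open>Fixing the entry state lets the invariants refer to the original array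
    \<open>snd s0 A\<close>.\<close>
  have "runs ((=) s0) (fft A) (L * (2 ^ L * 2)) Q" if s0: "P s0" for s0
  proof -
    have loop: "runs (fft_inv A L s0 0) (While (BLess (INum 1) (IVar ''S'')) (fft_round A))
        (L * (2 ^ L * 2)) (fft_inv A L s0 L)"
    proof (rule runs_While)
      show "bval (fst s) (BLess (INum 1) (IVar ''S'')) \<longleftrightarrow> l < L"
        if "l \<le> L" "fft_inv A L s0 l s" for l s
        using that one_less_power[of "2 :: nat" "L - l"] by (cases "l = L") (auto simp: fft_inv_def)
    qed (rule runs_fft_round[OF N[OF s0]])
    have post: "Q s" if "fft_inv A L s0 L s" for s
      using that by (intro Q[OF s0]) (auto simp: fft_inv_def partial_dft_full[simplified])
    have pre: "fft_inv A L s0 0 ((fst s0)(''S'' := 2 ^ L, ''l'' := 0), snd s0)"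
      by (auto simp: fft_inv_def fft_frame_def partial_dft_1[simplified])
    show ?thesis
      unfolding fft_def
      apply (rule runs_pre)
        apply (rule runs_Seq)+
          apply (rule runs_post[OF loop post], assumption)
         apply (rule runs_ISet)
        apply (rule runs_ISet)
      subgoal using pre N[OF s0] by auto
      by simp
  qed
  then show ?thesis unfolding runs_def by blast
qed


section \<open>The Pascal matrix as a convolution\<close>

text \<open>Length at least \<open>2 * n\<close> avoids wrap-around; minimality keeps it below
  \<open>4 * n\<close> for positive \<open>n\<close>.\<close>

definition log_size :: "nat \<Rightarrow> nat" where
  "log_size n = (LEAST l. 2 * n \<le> 2 ^ l)"

lemma log_size_le: "2 * n \<le> 2 ^ log_size n"
  unfolding log_size_def by (rule LeastI_ex) (metis less_exp order_less_imp_le)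

lemma less_log_size: "k < log_size n \<Longrightarrow> 2 ^ k < 2 * n"
  unfolding log_size_def by (metis not_le not_less_Least)

text \<open>Index variables cannot enter the complex part, so the cells \<open>e\<close> and \<open>d\<close> carry the complex
  numbers \<open>N\<close> and \<open>i\<close>, while \<open>g\<close> and \<open>h\<close> hold the factorials and the powers of two.\<close>

definition size_step :: com where
  "size_step =
     Seq (Store ''e'' (INum 0) (CAdd (CCell ''e'' (INum 0)) (CCell ''e'' (INum 0))))
     (Seq (ISet ''N'' (IMul (INum 2) (IVar ''N'')))
     (ISet ''L'' (IAdd (IVar ''L'') (INum 1))))"

text \<open>\<open>d\<close> is incremented before it is used, so the factorial recurrence
  multiplies by \<open>i + 1\<close>.\<close>

definition table_step :: com where
  "table_step =
     Seq (Store ''a'' (IVar ''i'') (CDiv (CCell ''x'' (IVar ''i'')) (CCell ''g'' (IVar ''i''))))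
     (Seq (Store ''b'' (IVar ''i'') (CDiv (CInt 1) (CCell ''g'' (IVar ''i''))))
     (Seq (Store ''d'' (INum 0) (CAdd (CCell ''d'' (INum 0)) (CInt 1)))
     (Seq (Store ''g'' (IAdd (IVar ''i'') (INum 1))
        (CMul (CCell ''g'' (IVar ''i'')) (CCell ''d'' (INum 0))))
     (Seq (Store ''h'' (IAdd (IVar ''i'') (INum 1))
        (CAdd (CCell ''h'' (IVar ''i'')) (CCell ''h'' (IVar ''i''))))
     (ISet ''i'' (IAdd (IVar ''i'') (INum 1)))))))"

text \<open>Level \<open>L\<close> is where the transform leaves its result.\<close>

definition top_cell :: "iexp \<Rightarrow> iexp" where
  "top_cell j = IAdd (IMul (IVar ''L'') (IVar ''N'')) j"

definition product_step :: com where
  "product_step =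
     Seq (Store ''c'' (IVar ''i'')
       (CMul (CCell ''a'' (top_cell (IVar ''i''))) (CCell ''b'' (top_cell (IVar ''i'')))))
     (ISet ''i'' (IAdd (IVar ''i'') (INum 1)))"

text \<open>The reflected index and the division by \<open>e\<close>, which holds \<open>N\<close>,
  turn the forward transform into an inverse one.\<close>

definition output_step :: com where
  "output_step =
     Seq (Store ''y'' (IVar ''i'')
       (CDiv
         (CMul (CCell ''g'' (IVar ''i''))
           (CCell ''c'' (top_cell (IMod (ISub (IVar ''N'') (IVar ''i'')) (IVar ''N'')))))
         (CMul (CCell ''h'' (IVar ''i'')) (CCell ''e'' (INum 0)))))
     (ISet ''i'' (IAdd (IVar ''i'') (INum 1)))"

text \<open>Initial zeros matter: \<open>i\<close>, \<open>L\<close> and \<open>d\<close> start at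
  0, and untouched cells of \<open>a\<close> and \<open>b\<close> provide the padding up to length
  \<open>N\<close>.\<close>

definition pascal_program :: com where
  "pascal_program =
     Seq (ISet ''N'' (INum 1))
     (Seq (Store ''e'' (INum 0) (CInt 1))
     (Seq (Store ''g'' (INum 0) (CInt 1))
     (Seq (Store ''h'' (INum 0) (CInt 1))
     (Seq (While (BLess (IVar ''N'') (IMul (INum 2) (IVar ''n''))) size_step)
     (Seq (While (BLess (IVar ''i'') (IVar ''n'')) table_step)
     (Seq (fft ''a'')
     (Seq (fft ''b'')
     (Seq (ISet ''i'' (INum 0))
     (Seq (While (BLess (IVar ''i'') (IVar ''N'')) product_step)
     (Seq (fft ''c'')
     (Seq (ISet ''i'' (INum 0))
     (While (BLess (IVar ''i'') (IVar ''n'')) output_step))))))))))))"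

section \<open>Loop invariants and their preservation\<close>

text \<open>The cutoff \<open>k\<close> is the loop counter while the tables grow, and marks the
  zero padding once \<open>k = n\<close>.\<close>

definition scaled_input :: "nat \<Rightarrow> (nat \<Rightarrow> complex) \<Rightarrow> nat \<Rightarrow> complex" where
  "scaled_input k x j = (if j < k then x j / fact j else 0)"

definition size_inv :: "nat \<Rightarrow> (nat \<Rightarrow> complex) \<Rightarrow> nat \<Rightarrow> state \<Rightarrow> bool" where
  "size_inv n x k s \<longleftrightarrow> fst s ''n'' = n \<and> fst s ''N'' = 2 ^ k \<and> fst s ''L'' = k \<and> fst s ''i'' = 0 \<and>
     snd s ''x'' = x \<and> snd s ''e'' 0 = 2 ^ k \<and> snd s ''d'' 0 = 0 \<and>
     snd s ''g'' 0 = 1 \<and> snd s ''h'' 0 = 1 \<and>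
     snd s ''a'' = (\<lambda>_. 0) \<and> snd s ''b'' = (\<lambda>_. 0)"

definition table_inv :: "nat \<Rightarrow> nat \<Rightarrow> (nat \<Rightarrow> complex) \<Rightarrow> nat \<Rightarrow> state \<Rightarrow> bool" where
  "table_inv n L x k s \<longleftrightarrow> fst s ''n'' = n \<and> fst s ''N'' = 2 ^ L \<and> fst s ''L'' = L \<and> fst s ''i'' = k \<and>
     snd s ''x'' = x \<and> snd s ''e'' 0 = 2 ^ L \<and> snd s ''d'' 0 = of_nat k \<and>
     (\<forall>j\<le>k. snd s ''g'' j = fact j \<and> snd s ''h'' j = 2 ^ j) \<and>
     snd s ''a'' = scaled_input k x \<and> snd s ''b'' = scaled_input k (\<lambda>_. 1)"

definition tables :: "nat \<Rightarrow> nat \<Rightarrow> state \<Rightarrow> bool" where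
  "tables n L s \<longleftrightarrow> fst s ''n'' = n \<and> fst s ''N'' = 2 ^ L \<and> fst s ''L'' = L \<and>
     snd s ''e'' 0 = 2 ^ L \<and> (\<forall>j\<le>n. snd s ''g'' j = fact j \<and> snd s ''h'' j = 2 ^ j)"

definition holds_dft :: "string \<Rightarrow> nat \<Rightarrow> (nat \<Rightarrow> complex) \<Rightarrow> state \<Rightarrow> bool" where
  "holds_dft A L a s \<longleftrightarrow> (\<forall>p<2 ^ L. snd s A (L * 2 ^ L + p) = dft (2 ^ L) a p)"

definition product_inv ::
  "nat \<Rightarrow> nat \<Rightarrow> (nat \<Rightarrow> complex) \<Rightarrow> (nat \<Rightarrow> complex) \<Rightarrow> nat \<Rightarrow> state \<Rightarrow> bool" where
  "product_inv n L a b k s \<longleftrightarrow> tables n L s \<and> fst s ''i'' = k \<and>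
     holds_dft ''a'' L a s \<and> holds_dft ''b'' L b s \<and>
     (\<forall>p<k. snd s ''c'' p = dft (2 ^ L) a p * dft (2 ^ L) b p)"

text \<open>The output is recorded as a raw transform value; its identification with the Pascal
  product is left to \<open>pascal_program_output\<close>.\<close>

definition output_inv :: "nat \<Rightarrow> nat \<Rightarrow> (nat \<Rightarrow> complex) \<Rightarrow> nat \<Rightarrow> state \<Rightarrow> bool" where
  "output_inv n L c k s \<longleftrightarrow> tables n L s \<and> fst s ''i'' = k \<and> holds_dft ''c'' L c s \<and>
     (\<forall>i<k. snd s ''y'' i = fact i * dft (2 ^ L) c ((2 ^ L - i) mod 2 ^ L) / (2 ^ i * 2 ^ L))"

lemma runs_size_step: "runs (size_inv n x k) size_step 1 (size_inv n x (Suc k))"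
  unfolding size_step_def
  apply (rule runs_pre)
    apply (rule runs_Seq runs_ISet runs_Store)+
   apply (auto simp: size_inv_def)
  done

lemma runs_table_step: "runs (table_inv n L x k) table_step 5 (table_inv n L x (Suc k))"
  unfolding table_step_def
  apply (rule runs_pre)
    apply (rule runs_Seq runs_ISet runs_Store)+
   apply (auto simp: table_inv_def scaled_input_def le_Suc_eq less_Suc_eq fun_eq_iff algebra_simps)
  done

lemma runs_product_step:
  assumes "k < 2 ^ L"
  shows "runs (product_inv n L a b k) product_step 1 (product_inv n L a b (Suc k))"
  unfolding product_step_def
  apply (rule runs_pre)
    apply (rule runs_Seq runs_ISet runs_Store)+
  using assms
   apply (auto simp: product_inv_def tables_def holds_dft_def top_cell_def less_Suc_eq)
  done

lemma runs_output_step: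
  assumes "k < n"
  shows "runs (output_inv n L c k) output_step 3 (output_inv n L c (Suc k))"
  unfolding output_step_def
  apply (rule runs_pre)
    apply (rule runs_Seq runs_ISet runs_Store)+
  using assms
   apply (auto simp: output_inv_def tables_def holds_dft_def top_cell_def less_Suc_eq)
  done

text \<open>The terms count the doublings, five operations per table entry plus three per output
  entry, three transforms of \<open>2 * L * N\<close> each, and the pointwise products.\<close>

definition program_cost :: "nat \<Rightarrow> nat" where
  "program_cost n = (let L = log_size n; N = 2 ^ L in L + 8 * n + 6 * L * N + N)"

section \<open>The whole program, its output and its cost\<close>

lemma runs_pascal_program:
  fixes n :: nat and x :: "nat \<Rightarrow> complex"
  defines "L \<equiv> log_size n"
  defines "a \<equiv> scaled_input n x" and "b \<equiv> scaled_input n (\<lambda>_. 1)"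
  defines "c \<equiv> (\<lambda>p. dft (2 ^ L) a p * dft (2 ^ L) b p)"
  assumes x: "\<And>j. j < n \<Longrightarrow> x j = complex_of_real (v $ j)" "\<And>j. j \<ge> n \<Longrightarrow> x j = 0"
  shows "runs ((=) (input_state n v)) pascal_program (program_cost n) (output_inv n L c n)"
proof -
  have size_loop: "runs (size_inv n x 0) (While (BLess (IVar ''N'') (IMul (INum 2) (IVar ''n''))) size_step)
      (L * 1) (size_inv n x L)"
  proof (rule runs_While)
    \<comment> \<open>By minimality of \<open>log_size n\<close>, \<open>2 ^ k < 2 * n\<close> holds
      for every \<open>k < L\<close> and fails at \<open>L\<close>.\<close>
    show "bval (fst s) (BLess (IVar ''N'') (IMul (INum 2) (IVar ''n''))) \<longleftrightarrow> k < L"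
      if "k \<le> L" "size_inv n x k s" for k s
      using that log_size_le[of n] less_log_size[of k n]
      by (cases "k = L") (auto simp: size_inv_def L_def)
  qed (rule runs_size_step)
  have table_loop: "runs (table_inv n L x 0) (While (BLess (IVar ''i'') (IVar ''n'')) table_step)
      (n * 5) (table_inv n L x n)"
    by (rule runs_While[where I = "table_inv n L x", OF runs_table_step]) (simp add: table_inv_def)
  have product_loop: "runs (product_inv n L a b 0) (While (BLess (IVar ''i'') (IVar ''N'')) product_step)
      (2 ^ L * 1) (product_inv n L a b (2 ^ L))"
    by (rule runs_While[where I = "product_inv n L a b", OF runs_product_step])
      (simp_all add: product_inv_def tables_def)
  have output_loop: "runs (output_inv n L c 0) (While (BLess (IVar ''i'') (IVar ''n'')) output_step)
      (n * 3) (output_inv n L c n)"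
    by (rule runs_While[where I = "output_inv n L c", OF runs_output_step])
      (simp_all add: output_inv_def tables_def)
  have fft_a: "runs (table_inv n L x n) (fft ''a'') (L * (2 ^ L * 2))
      (\<lambda>s. tables n L s \<and> holds_dft ''a'' L a s \<and> snd s ''b'' = b)"
    by (rule runs_fft)
      (auto simp: table_inv_def tables_def holds_dft_def fft_frame_def a_def b_def)
  have fft_b: "runs (\<lambda>s. tables n L s \<and> holds_dft ''a'' L a s \<and> snd s ''b'' = b)
      (fft ''b'') (L * (2 ^ L * 2)) (\<lambda>s. tables n L s \<and> holds_dft ''a'' L a s \<and> holds_dft ''b'' L b s)"
    by (rule runs_fft) (auto simp: tables_def holds_dft_def fft_frame_def)
  have fft_c: "runs (product_inv n L a b (2 ^ L)) (fft ''c'') (L * (2 ^ L * 2))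
      (\<lambda>s. tables n L s \<and> holds_dft ''c'' L c s)"
  proof (rule runs_fft)
    fix s s'
    assume inv: "product_inv n L a b (2 ^ L) s" and frame: "fft_frame ''c'' s s'"
      and dft: "\<And>p. p < 2 ^ L \<Longrightarrow> snd s' ''c'' (L * 2 ^ L + p) = dft (2 ^ L) (snd s ''c'') p"
    \<comment> \<open>The transform reads only cells below \<open>2 ^ L\<close>, which are those the
      product loop has filled.\<close>
    have "dft (2 ^ L) (snd s ''c'') p = dft (2 ^ L) c p" for p
      unfolding dft_def using inv by (intro sum.cong) (auto simp: product_inv_def c_def)
    then show "tables n L s' \<and> holds_dft ''c'' L c s'"
      using inv frame dft by (simp add: product_inv_def tables_def holds_dft_def fft_frame_def)
  qed (simp add: product_inv_def tables_def)
  have x_input: "(\<lambda>i. if i < n then complex_of_real (v $ i) else 0) = x"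
    using x by (auto simp: fun_eq_iff not_less)
  show ?thesis
    unfolding pascal_program_def
    apply (rule runs_pre)
      apply (rule runs_Seq)+
                  apply (rule output_loop)
                 apply (rule runs_ISet)
                apply (rule runs_post[OF fft_c])
    subgoal by (auto simp: output_inv_def tables_def holds_dft_def)
               apply (rule product_loop)
              apply (rule runs_ISet)
             apply (rule runs_post[OF fft_b])
    subgoal by (auto simp: product_inv_def tables_def holds_dft_def)
            apply (rule fft_a)
           apply (rule table_loop)
          apply (rule runs_post[OF size_loop])
    subgoal by (auto simp: size_inv_def table_inv_def scaled_input_def fun_eq_iff)
         apply (rule runs_Store)
        apply (rule runs_Store)
       apply (rule runs_Store)
      apply (rule runs_ISet)
    subgoal by (auto simp: size_inv_def input_state_def x_input)
    by (simp add: program_cost_def Let_def L_def)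
qed

text \<open>The factor \<open>2 ^ L\<close> from \<open>dft_convolution\<close> cancels against the
  denominator, and \<open>fact i / (fact j * fact (i - j))\<close> is the binomial
  coefficient.\<close>

lemma pascal_program_output:
  assumes v: "v \<in> carrier_vec n"
    and out: "output_inv n (log_size n) (\<lambda>p. dft (2 ^ log_size n) (scaled_input n x) p *
      dft (2 ^ log_size n) (scaled_input n (\<lambda>_. 1)) p) n s"
    and x: "\<And>j. j < n \<Longrightarrow> x j = complex_of_real (v $ j)"
  shows "output_vec n s = map_vec complex_of_real (pascal_Q n *\<^sub>v v)"
proof (rule eq_vecI)
  fix i assume "i < dim_vec (map_vec complex_of_real (pascal_Q n *\<^sub>v v))"
  then have i: "i < n" by (simp add: pascal_Q_def)
  \<comment> \<open>All indices are at most \<open>i < n\<close>, so the cutoff in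
    \<open>scaled_input\<close> never applies.\<close>
  have *: "(\<Sum>j\<le>i. scaled_input n x j * scaled_input n (\<lambda>_. 1) (i - j))
      = (\<Sum>j\<le>i. complex_of_real (v $ j) / (fact j * fact (i - j)))"
    using i x by (intro sum.cong) (auto simp: scaled_input_def)
  have "output_vec n s $ i = fact i * (\<Sum>j\<le>i. complex_of_real (v $ j) / (fact j * fact (i - j))) / 2 ^ i"
    using out i unfolding *[symmetric] output_inv_def output_vec_def
    by (simp add: dft_convolution[OF log_size_le i] scaled_input_def)
  also have "\<dots> = (\<Sum>j\<le>i. complex_of_real (real (i choose j) / 2 ^ i * v $ j))"
    unfolding sum_distrib_left sum_divide_distrib
    by (intro sum.cong refl) (simp add: binomial_fact field_simps)
  \<comment> \<open>Columns beyond the diagonal contribute zero, so the sum may run over the whole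
    row.\<close>
  also have "\<dots> = complex_of_real (\<Sum>j\<in>{0..<n}. (if j \<le> i then real (i choose j) / 2 ^ i else 0) * v $ j)"
    unfolding of_real_sum
    by (rule sum.mono_neutral_cong_left) (use i in auto)
  also have "\<dots> = map_vec complex_of_real (pascal_Q n *\<^sub>v v) $ i"
    using i v by (auto simp: pascal_Q_def scalar_prod_def intro!: sum.cong)
  finally show "output_vec n s $ i = map_vec complex_of_real (pascal_Q n *\<^sub>v v) $ i" .
qed (simp add: output_vec_def pascal_Q_def)

text \<open>The cost is of order \<open>n * ln n\<close>, since \<open>2 ^ L < 4 * n\<close> for
  positive \<open>n\<close>; one more logarithm absorbs the constants for large
  \<open>n\<close>.\<close>

lemma program_cost_bigo: "(\<lambda>n. real (program_cost n)) \<in> O(\<lambda>n. real n * (ln (real n))\<^sup>2)"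
proof -
  \<comment> \<open>100 is generous: with \<open>l = ln n / ln 2 + 2 \<ge> 2\<close> the four terms
    are at most 1, 4, 24 and 2 times \<open>l * n\<close>.\<close>
  have bound: "real (program_cost n) \<le> 100 * (real n * (ln (real n) / ln 2 + 2))" if n: "n > 0" for n
  proof -
    define L where "L = log_size n"
    \<comment> \<open>As \<open>2 ^ 0 < 2 * n\<close>, the exponent is positive and minimality
      applies to \<open>L - 1\<close>.\<close>
    have "L > 0"
      using log_size_le[of n] n unfolding L_def by (cases "log_size n") auto
    then have "2 ^ (L - 1) < 2 * n" using less_log_size[of "L - 1" n] by (simp add: L_def)
    then have "2 ^ L < 4 * n" using \<open>L > 0\<close> by (cases L) auto
    then have N: "real (2 ^ L) \<le> real (4 * n)" by (simp only: of_nat_le_iff)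
    have "ln (2 ^ L) \<le> ln (4 * real n)"
      using N n by (subst ln_le_cancel_iff) auto
    moreover have "ln (4 :: real) = 2 * ln 2" using ln_realpow[of 2 2] by simp
    ultimately have "real L * ln 2 \<le> 2 * ln 2 + ln (real n)"
      using n by (simp add: ln_mult ln_realpow)
    then have L: "real L \<le> ln (real n) / ln 2 + 2"
      by (simp add: field_simps)
    define l where "l = ln (real n) / ln 2 + 2"
    have l: "l \<ge> 2" using n by (simp add: l_def)
    have 1: "real L * real (2 ^ L) \<le> l * (4 * real n)"
      using L N l by (intro mult_mono) (auto simp: l_def)
    have 2: "2 * real n \<le> l * real n" "l * 1 \<le> l * real n"
      using l n by (auto intro!: mult_right_mono mult_left_mono)
    have "real (program_cost n) = real L + 8 * real n + 6 * (real L * real (2 ^ L)) + real (2 ^ L)"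
      by (simp add: program_cost_def Let_def L_def)
    also have "\<dots> \<le> 100 * (real n * l)"
      using 1 2 N L unfolding l_def[symmetric] by (simp add: mult.commute)
    finally show ?thesis by (simp add: l_def)
  qed
  have "(\<lambda>n. real (program_cost n)) \<in> O(\<lambda>n. real n * (ln (real n) / ln 2 + 2))"
  proof (intro bigoI[of _ 100] eventually_mono[OF eventually_gt_at_top[of 0]])
    fix n :: nat assume "n > 0"
    then have "real (program_cost n) \<le> 100 * (real n * (ln (real n) / ln 2 + 2))"
      by (rule bound)
    also have "\<dots> \<le> 100 * norm (real n * (ln (real n) / ln 2 + 2))"
      unfolding real_norm_def by (intro mult_left_mono abs_ge_self) simp
    finally show "norm (real (program_cost n)) \<le> 100 * norm (real n * (ln (real n) / ln 2 + 2))"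
      by simp
  qed
  also have "(\<lambda>n. real n * (ln (real n) / ln 2 + 2)) \<in> O(\<lambda>n. real n * (ln (real n))\<^sup>2)"
    by real_asymp
  finally show ?thesis .
qed

theorem mainTheorem3:
  "\<exists>(P :: com) (T :: nat \<Rightarrow> nat).
     (\<forall>n > 0. \<forall>x \<in> carrier_vec n. \<exists>t s.
        exec P (input_state n x) t s \<and>
        output_vec n s = map_vec complex_of_real (pascal_Q n *\<^sub>v x) \<and>
        t \<le> T n) \<and>
     (\<lambda>n. real (T n)) \<in> O(\<lambda>n. real n * (ln (real n))\<^sup>2)"
proof (rule exI[of _ pascal_program], rule exI[of _ program_cost], intro conjI allI impI ballI)
  fix n :: nat and x :: "real vec" assume x: "x \<in> carrier_vec n"
  \<comment> \<open>Extension by zero, matching the array \<open>x\<close> of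
    \<open>input_state\<close>.\<close>
  define x' where "x' = (\<lambda>j. if j < n then complex_of_real (x $ j) else 0)"
  have x': "\<And>j. j < n \<Longrightarrow> x' j = complex_of_real (x $ j)" "\<And>j. j \<ge> n \<Longrightarrow> x' j = 0"
    by (simp_all add: x'_def)
  show "\<exists>t s. exec pascal_program (input_state n x) t s \<and>
      output_vec n s = map_vec complex_of_real (pascal_Q n *\<^sub>v x) \<and> t \<le> program_cost n"
    using runs_pascal_program[OF x'] pascal_program_output[OF x _ x'(1)]
    unfolding runs_def by blast
qed (rule program_cost_bigo)

end
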